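(* Let $E=\mathrm{Dend}_2^1$ be the two-dimensional complex dendriform algebra with basis $\{e_1,e_2\}$ and products $e_1\prec e_1=e_1$, $e_1\succ e_2=e_2$, all other products of basis elements under $\prec$ and $\succ$ being zero. Then the averaging operators on $E$ are exactly the linear maps $P:E\to E$ whose matrix is of one of the forms $$P_1=\begin{pmatrix}0&a_{12}\\0&0\end{pmatrix},\quad P_2=\begin{pmatrix}a_{11}&0\\0&0\end{pmatrix},\quad P_3=\begin{pmatrix}a_{22}&0\\0&a_{22}\end{pmatrix},$$ with $a_{11},a_{12},a_{22}\in\mathbb{C}$ arbitrary.
   Context: A dendriform algebra over $\mathbb{C}$ is a complex vector space $E$ with bilinear operations $\prec,\succ$ satisfying, for all $u,v,w\in E$: $(u\prec v)\prec w=u\prec(v\prec w)+u\prec(v\succ w)$; $(u\succ v)\prec w=u\succ(v\prec w)$; $u\succ(v\succ w)=(u\prec v)\succ w+(u\succ v)\succ w$. Matrix convention: the matrix $(a_{ij})$ of a linear map $P:E\to E$ is defined by rows, $P(e_1)=a_{11}e_1+a_{12}e_2$ and $P(e_2)=a_{21}e_1+a_{22}e_2$. An averaging operator on $E$ is a linear map $P:E\to E$ such that for all $u,v\in E$: $$P(u)\prec P(v)=P\big(u\prec P(v)\big)=P\big(P(u)\prec v\big),$$ $$P(u)\succ P(v)=P\big(u\succ P(v)\big)=P\big(P(u)\succ v\big).$$ *)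

theory Defs
  imports "HOL-Analysis.Analysis"
begin

locale dendriform_algebra = vector_space smul
  for smul :: "complex \<Rightarrow> 'a::ab_group_add \<Rightarrow> 'a" +
  fixes prec :: "'a \<Rightarrow> 'a \<Rightarrow> 'a" (infixl \<open>\<prec>\<close> 70)
    and succ :: "'a \<Rightarrow> 'a \<Rightarrow> 'a" (infixl \<open>\<succ>\<close> 70)
  assumes linear_prec_left: "\<And>v. Vector_Spaces.linear smul smul (\<lambda>u. u \<prec> v)"
    and linear_prec_right: "\<And>u. Vector_Spaces.linear smul smul (\<lambda>v. u \<prec> v)"
    and linear_succ_left: "\<And>v. Vector_Spaces.linear smul smul (\<lambda>u. u \<succ> v)"
    and linear_succ_right: "\<And>u. Vector_Spaces.linear smul smul (\<lambda>v. u \<succ> v)"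
    and prec_prec: "\<And>u v w. (u \<prec> v) \<prec> w = u \<prec> (v \<prec> w) + u \<prec> (v \<succ> w)"
    and succ_prec: "\<And>u v w. (u \<succ> v) \<prec> w = u \<succ> (v \<prec> w)"
    and succ_succ: "\<And>u v w. u \<succ> (v \<succ> w) = (u \<prec> v) \<succ> w + (u \<succ> v) \<succ> w"

locale Dend_2_1 = dendriform_algebra smul prec succ
  for smul :: "complex \<Rightarrow> 'a::ab_group_add \<Rightarrow> 'a"
    and prec (infixl \<open>\<prec>\<close> 70) and succ (infixl \<open>\<succ>\<close> 70) +
  fixes e1 e2 :: 'a
  assumes e1_neq_e2: "e1 \<noteq> e2"
    and independent_basis: "independent {e1, e2}"
    and span_basis: "span {e1, e2} = UNIV"
    and e1_prec_e1: "e1 \<prec> e1 = e1"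
    and e1_prec_e2: "e1 \<prec> e2 = 0"
    and e2_prec_e1: "e2 \<prec> e1 = 0"
    and e2_prec_e2: "e2 \<prec> e2 = 0"
    and e1_succ_e1: "e1 \<succ> e1 = 0"
    and e1_succ_e2: "e1 \<succ> e2 = e2"
    and e2_succ_e1: "e2 \<succ> e1 = 0"
    and e2_succ_e2: "e2 \<succ> e2 = 0"

definition averaging_operator ::
  "(complex \<Rightarrow> 'a::ab_group_add \<Rightarrow> 'a) \<Rightarrow> ('a \<Rightarrow> 'a \<Rightarrow> 'a) \<Rightarrow> ('a \<Rightarrow> 'a \<Rightarrow> 'a) \<Rightarrow> ('a \<Rightarrow> 'a) \<Rightarrow> bool"
  where "averaging_operator smul prec succ P \<longleftrightarrow>
    Vector_Spaces.linear smul smul P \<and>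
    (\<forall>u v. prec (P u) (P v) = P (prec u (P v)) \<and> P (prec u (P v)) = P (prec (P u) v) \<and>
           succ (P u) (P v) = P (succ u (P v)) \<and> P (succ u (P v)) = P (succ (P u) v))"

text \<open>Row convention: the coordinates of the image of the \<open>i\<close>-th basis vector form the
  \<open>i\<close>-th row, so this is the transpose of the matrix acting on column vectors.\<close>

definition has_row_matrix ::
  "(complex \<Rightarrow> 'a::ab_group_add \<Rightarrow> 'a) \<Rightarrow> 'a \<Rightarrow> 'a \<Rightarrow> ('a \<Rightarrow> 'a) \<Rightarrow> complex^2^2 \<Rightarrow> bool"
  where "has_row_matrix smul e1 e2 P A \<longleftrightarrow>
    P e1 = smul (A $ 1 $ 1) e1 + smul (A $ 1 $ 2) e2 \<and>
    P e2 = smul (A $ 2 $ 1) e1 + smul (A $ 2 $ 2) e2"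

text \<open>The algebra exists: a model on \<open>\<complex>\<^sup>2\<close> with the standard basis.\<close>

lemma Dend_2_1_model:
  "Dend_2_1 (*s)
     (\<lambda>u v :: complex^2. axis 1 (u $ 1 * v $ 1))
     (\<lambda>u v. axis 2 (u $ 1 * v $ 2))
     (axis 1 1) (axis 2 1)"
proof -
  have basis: "cart_basis = {axis 1 1, axis 2 1 :: complex^2}"
    by (auto simp: cart_basis_def exhaust_2) (metis exhaust_2)
  have "vec.independent {axis 1 1, axis 2 1 :: complex^2}"
    "vec.span {axis 1 1, axis 2 1 :: complex^2} = UNIV"
    using independent_cart_basis[where 'a = complex and 'b = 2]
      span_cart_basis[where 'a = complex and 'b = 2]
    unfolding basis by auto
  then show ?thesis
    by unfold_locales
      (auto simp: vec_eq_iff axis_def algebra_simps)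
qed

end

theory Submission
  imports Defs
begin

text \<open>In coordinates \<open>(x, y)\<close> with respect to \<open>e1\<close>,
  \<open>e2\<close>, the products are \<open>(x * x', 0)\<close> and \<open>(0, x * y')\<close>. If
  \<open>P\<close> has rows \<open>(a, b)\<close> and \<open>(c, d)\<close>, the averaging laws are
  polynomial identities in the coordinates of \<open>u\<close> and \<open>v\<close>. Testing them on
  basis vectors leaves \<open>c = 0\<close>, \<open>a * b = 0\<close>, \<open>d * b = 0\<close>,
  \<open>d * (a - d) = 0\<close>, and these also suffice
  (\<open>averaging_operator_iff_coeffs\<close>). The solutions are exactly the three families
  (\<open>averaging_operator_iff_forms\<close>).\<close>

context Dend_2_1
begin

definition vec_of :: "complex \<Rightarrow> complex \<Rightarrow> 'a"
  where "vec_of x y = smul x e1 + smul y e2"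

lemma vec_of_eq_iff: "vec_of x y = vec_of x' y' \<longleftrightarrow> x = x' \<and> y = y'"
proof
  assume "vec_of x y = vec_of x' y'"
  then have sum: "smul (x - x') e1 + smul (y - y') e2 = 0"
    by (simp add: vec_of_def scale_left_diff_distrib algebra_simps)
  \<comment> \<open>\<open>independentD\<close> expects coefficients indexed by the vectors
    themselves; \<open>e1_neq_e2\<close> makes this indexing faithful.\<close>
  define f where "f v = (if v = e1 then x - x' else y - y')" for v
  have "(\<Sum>v\<in>{e1, e2}. smul (f v) v) = 0"
    using sum e1_neq_e2 by (simp add: f_def)
  then have "f v = 0" if "v \<in> {e1, e2}" for v
    using independentD[OF independent_basis, of "{e1, e2}" f v] that by simp
  from this[of e1] this[of e2] show "x = x' \<and> y = y'"
    using e1_neq_e2 by (simp add: f_def)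
qed simp

lemma vec_of_exhaust:
  obtains x y where "u = vec_of x y"
proof -
  have "u \<in> span {e1, e2}"
    by (simp add: span_basis)
  then obtain x y where "u - smul x e1 - smul y e2 = 0"
    unfolding span_insert by auto
  then have "u = vec_of x y"
    by (simp add: vec_of_def algebra_simps)
  then show thesis ..
qed

lemma forall_vec_of: "(\<forall>u. Q u) \<longleftrightarrow> (\<forall>x y. Q (vec_of x y))"
  by (metis vec_of_exhaust)

lemma prec_vec_of: "vec_of x y \<prec> vec_of x' y' = vec_of (x * x') 0"
  using linear_prec_left linear_prec_right
  by (simp add: vec_of_def Vector_Spaces.linear_iff e1_prec_e1 e1_prec_e2 e2_prec_e1 e2_prec_e2
      mult.commute)

lemma succ_vec_of: "vec_of x y \<succ> vec_of x' y' = vec_of 0 (x * y')"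
  using linear_succ_left linear_succ_right
  by (simp add: vec_of_def Vector_Spaces.linear_iff e1_succ_e1 e1_succ_e2 e2_succ_e1 e2_succ_e2
      mult.commute)

text \<open>Images of basis vectors are rows, so coordinates transform by the transposed
  matrix.\<close>

lemma linear_vec_of:
  assumes "Vector_Spaces.linear smul smul P" "P e1 = vec_of a b" "P e2 = vec_of c d"
  shows "P (vec_of x y) = vec_of (a * x + c * y) (b * x + d * y)"
  using assms
  by (simp add: vec_of_def Vector_Spaces.linear_iff scale_right_distrib scale_left_distrib
      mult.commute add_ac)

lemma averaging_operator_iff_coeffs:
  assumes P: "Vector_Spaces.linear smul smul P" "P e1 = vec_of a b" "P e2 = vec_of c d"
  shows "averaging_operator smul (\<prec>) (\<succ>) P \<longleftrightarrow>
    c = 0 \<and> a * b = 0 \<and> d * b = 0 \<and> d * (a - d) = 0"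
    (is "?L \<longleftrightarrow> ?R")
proof -
  note coords = prec_vec_of succ_vec_of linear_vec_of[OF P] vec_of_eq_iff
  \<comment> \<open>Each of the four equalities of vectors splits into two coordinates.\<close>
  have L: "?L \<longleftrightarrow> (\<forall>x y x' y'.
      (a * x + c * y) * (a * x' + c * y') = a * (x * (a * x' + c * y')) \<and>
      0 = b * (x * (a * x' + c * y')) \<and>
      a * (x * (a * x' + c * y')) = a * ((a * x + c * y) * x') \<and>
      b * (x * (a * x' + c * y')) = b * ((a * x + c * y) * x') \<and>
      0 = c * (x * (b * x' + d * y')) \<and>
      (a * x + c * y) * (b * x' + d * y') = d * (x * (b * x' + d * y')) \<and>
      c * (x * (b * x' + d * y')) = c * ((a * x + c * y) * y') \<and>
      d * (x * (b * x' + d * y')) = d * ((a * x + c * y) * y'))"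
    unfolding averaging_operator_def forall_vec_of
    \<comment> \<open>Without the deletion, equations with zero would break up into
      disjunctions.\<close>
    using P(1) by (simp add: coords conj_assoc del: mult_eq_0_iff)
  show ?thesis
  proof
    assume ?L
    note eqs = this[unfolded L, rule_format]
    \<comment> \<open>Taking \<open>u = v = e2\<close> gives \<open>c * c = 0\<close>.\<close>
    have "c = 0" using eqs[of 0 1 0 1] by simp
    \<comment> \<open>Now \<open>u = v = e1\<close> gives \<open>a * b = 0\<close> and
      \<open>a * b = d * b\<close>; \<open>u = e1\<close>, \<open>v = e2\<close> gives
      \<open>a * d = d * d\<close>.\<close>
    then show ?R using eqs[of 1 0 1 0] eqs[of 1 0 0 1] by (auto simp: algebra_simps)
  next
    assume ?R
    then show ?L unfolding L by auto
  qed
qed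

text \<open>If \<open>b\<close> is nonzero then \<open>a = d = 0\<close>, the first form. If
  \<open>b = 0\<close>, then \<open>d = 0\<close> gives the second form and \<open>a = d\<close> the
  third.\<close>

lemma averaging_operator_iff_forms:
  assumes lin: "Vector_Spaces.linear smul smul P"
  shows "averaging_operator smul (\<prec>) (\<succ>) P \<longleftrightarrow>
    (\<exists>b. P e1 = vec_of 0 b \<and> P e2 = vec_of 0 0) \<or>
    (\<exists>a. P e1 = vec_of a 0 \<and> P e2 = vec_of 0 0) \<or>
    (\<exists>d. P e1 = vec_of d 0 \<and> P e2 = vec_of 0 d)"
proof -
  obtain a b where 1: "P e1 = vec_of a b" by (rule vec_of_exhaust)
  obtain c d where 2: "P e2 = vec_of c d" by (rule vec_of_exhaust)
  show ?thesis
    unfolding averaging_operator_iff_coeffs[OF lin 1 2] unfolding 1 2 vec_of_eq_iff by auto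
qed

end

theorem theorem2p5:
  fixes smul :: "complex \<Rightarrow> 'a::ab_group_add \<Rightarrow> 'a"
    and prec succ :: "'a \<Rightarrow> 'a \<Rightarrow> 'a"
    and e1 e2 :: 'a
  assumes "Dend_2_1 smul prec succ e1 e2"
  shows "{P. averaging_operator smul prec succ P} =
    {P. Vector_Spaces.linear smul smul P \<and>
        ((\<exists>a12. has_row_matrix smul e1 e2 P (vector [vector [0, a12], vector [0, 0]])) \<or>
         (\<exists>a11. has_row_matrix smul e1 e2 P (vector [vector [a11, 0], vector [0, 0]])) \<or>
         (\<exists>a22. has_row_matrix smul e1 e2 P (vector [vector [a22, 0], vector [0, a22]])))}"
proof -
  interpret Dend_2_1 smul prec succ e1 e2 by fact
  have "averaging_operator smul prec succ P \<Longrightarrow> Vector_Spaces.linear smul smul P" for P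
    by (simp add: averaging_operator_def)
  then show ?thesis
    \<comment> \<open>Folding \<open>vec_of\<close> turns each matrix row into the coordinate form
      of the lemma.\<close>
    unfolding has_row_matrix_def vector_2 vec_of_def[symmetric]
    using averaging_operator_iff_forms by blast
qed

end
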